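(* Given a PEPA model, let $X(t)$ be the solution of its derived ODEs $\frac{\mathrm{d}\mathbf{x}}{\mathrm{d}t}=\sum_l l\,f(\mathbf{x},l)$ with initial condition $\mathbf{x}_0$, let $\{X_n(t)\}$ be the density dependent CTMCs associated with $\mathbf{x}_0$ underlying the same model, and let $\hat X_n(t)=X_n(t)/n$. Then for any $t>0$, $$\lim_{n\to\infty}\sup_{u\le t}\|\hat X_n(u)-X(u)\|=0\quad\text{almost surely.}$$
   Context: A PEPA model (positive real rates, no passive rates) has $d$ local derivatives in total; a numerical state is $\mathbf{x}\in\mathbb{Z}_{\ge0}^d$. With $r_\alpha^{P\to Q}$ the rate of transition $P\xrightarrow{\alpha}Q$ and $r_\alpha(P)=\sum_Q r_\alpha^{P\to Q}$, the labelled activities are: for an individual action $\alpha$, $\alpha^{P\to Q}$ with rate function $f(\mathbf{x},\alpha^{P\to Q})=\mathbf{x}[P]r_\alpha^{P\to Q}$; for a shared action $\alpha$ with enabling local derivatives $P_1,\dots,P_k$ (distinct component types), $\alpha^w$ for each $w=(P_1\to Q_1,\dots,P_k\to Q_k)$ with rate function $f(\mathbf{x},\alpha^w)=\big(\prod_i r_\alpha^{P_i\to Q_i}/r_\alpha(P_i)\big)\min_i\{\mathbf{x}[P_i]r_\alpha(P_i)\}$. Each labelled activity $l$ is identified with its transition vector $l\in\{-1,0,1\}^d$ ($+1$ on its post set, $-1$ on its pre set). The derived ODEs sum over all labelled activities. For a numerical state $\mathbf{x}_0$, the density dependent CTMCs associated with $\mathbf{x}_0$ are the CTMCs $X_n(t)$,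 $n\in\mathbb{N}$, with $X_n(0)=n\mathbf{x}_0$, state space the numerical states reachable from $n\mathbf{x}_0$, and transition rates $q^{(n)}_{\mathbf{x},\mathbf{x}+l}=f(\mathbf{x},l)$ $(=nf(\mathbf{x}/n,l))$. *)

theory Defs
  imports "HOL-Probability.Probability"
begin

text \<open>
  A PEPA model is given by its local transition system. The type \<open>'d\<close> is the set of all local
  derivatives (so \<open>CARD('d)\<close> is the dimension), \<open>comp P\<close> is the type of the component that
  the local derivative \<open>P\<close> belongs to, and \<open>trate \<alpha> P Q\<close> is the total rate of the
  transitions from \<open>P\<close> to \<open>Q\<close> by \<open>\<alpha>\<close>; rates of existing transitions are positive,
  and \<open>0\<close> means that there is no such transition. Actions that are not shared are individual.
\<close>

record ('a, 'd, 'c) pepa =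
  actions :: "'a set"
  shared :: "'a set"
  comp :: "'d \<Rightarrow> 'c"
  trate :: "'a \<Rightarrow> 'd \<Rightarrow> 'd \<Rightarrow> real"

definition post :: "('a, 'd, 'c) pepa \<Rightarrow> 'd \<Rightarrow> 'a \<Rightarrow> 'd set" where
  "post \<M> P \<alpha> = {Q. trate \<M> \<alpha> P Q > 0}"

definition enabling :: "('a, 'd, 'c) pepa \<Rightarrow> 'a \<Rightarrow> 'd set" where
  "enabling \<M> \<alpha> = {P. post \<M> P \<alpha> \<noteq> {}}"

definition apparent_rate :: "('a, 'd::finite, 'c) pepa \<Rightarrow> 'a \<Rightarrow> 'd \<Rightarrow> real" where
  "apparent_rate \<M> \<alpha> P = (\<Sum>Q\<in>UNIV. trate \<M> \<alpha> P Q)"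

definition pepa_model :: "('a, 'd::finite, 'c) pepa \<Rightarrow> bool" where
  "pepa_model \<M> \<longleftrightarrow>
     finite (actions \<M>) \<and> shared \<M> \<subseteq> actions \<M> \<and>
     (\<forall>\<alpha>\<in>actions \<M>. \<forall>P Q. trate \<M> \<alpha> P Q \<ge> 0) \<and>
     (\<forall>\<alpha>\<in>actions \<M>. \<forall>P. \<forall>Q\<in>post \<M> P \<alpha>. comp \<M> Q = comp \<M> P) \<and>
     (\<forall>\<alpha>\<in>shared \<M>. enabling \<M> \<alpha> \<noteq> {} \<and> inj_on (comp \<M>) (enabling \<M> \<alpha>))"

text \<open>
  In \<open>Shared \<alpha> w\<close> the function \<open>w\<close> maps each enabling local derivative \<open>P\<^sub>i\<close> of
  \<open>\<alpha>\<close> to its successor \<open>Q\<^sub>i\<close>; it is \<open>undefined\<close> elsewhere, so that distinct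
  functions are distinct labels.
\<close>

datatype ('a, 'd) lact = Indiv 'a 'd 'd | Shared 'a "'d \<Rightarrow> 'd"

definition labelled_activities :: "('a, 'd, 'c) pepa \<Rightarrow> ('a, 'd) lact set" where
  "labelled_activities \<M> =
     {Indiv \<alpha> P Q | \<alpha> P Q. \<alpha> \<in> actions \<M> - shared \<M> \<and> Q \<in> post \<M> P \<alpha>} \<union>
     {Shared \<alpha> w | \<alpha> w. \<alpha> \<in> shared \<M> \<and>
        w \<in> (\<Pi>\<^sub>E P\<in>enabling \<M> \<alpha>. post \<M> P \<alpha>)}"

fun rate_fun :: "('a, 'd::finite, 'c) pepa \<Rightarrow> real^'d \<Rightarrow> ('a, 'd) lact \<Rightarrow> real" where
  "rate_fun \<M> x (Indiv \<alpha> P Q) = x $ P * trate \<M> \<alpha> P Q"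
| "rate_fun \<M> x (Shared \<alpha> w) =
     (\<Prod>P\<in>enabling \<M> \<alpha>. trate \<M> \<alpha> P (w P) / apparent_rate \<M> \<alpha> P) *
     Min ((\<lambda>P. x $ P * apparent_rate \<M> \<alpha> P) ` enabling \<M> \<alpha>)"

text \<open>
  The change of the numerical state: \<open>+1\<close> on the post set and \<open>-1\<close> on the pre set of the
  labelled activity, the two contributions cancelling for a local transition \<open>P \<rightarrow> P\<close>.
\<close>

fun transition_vec :: "('a, 'd::finite, 'c) pepa \<Rightarrow> ('a, 'd) lact \<Rightarrow> real^'d" where
  "transition_vec \<M> (Indiv \<alpha> P Q) = axis Q 1 - axis P 1"
| "transition_vec \<M> (Shared \<alpha> w) = (\<Sum>P\<in>enabling \<M> \<alpha>. axis (w P) 1 - axis P 1)"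

definition real_state :: "nat^'d \<Rightarrow> real^'d" where
  "real_state x = (\<chi> P. real (x $ P))"

definition derived_ode_solution ::
    "('a, 'd::finite, 'c) pepa \<Rightarrow> nat^'d \<Rightarrow> (real \<Rightarrow> real^'d) \<Rightarrow> bool" where
  "derived_ode_solution \<M> x0 X \<longleftrightarrow>
     X 0 = real_state x0 \<and>
     (\<forall>t\<ge>0. (X has_vector_derivative
        (\<Sum>l\<in>labelled_activities \<M>. rate_fun \<M> (X t) l *\<^sub>R transition_vec \<M> l))
        (at t within {0..}))"

text \<open>
  Different labelled activities may have the same transition vector (for instance, two actions
  leading from \<open>P\<close> to \<open>Q\<close>); their rates add up in the Markov chain.
\<close>

definition jump_rate :: "('a, 'd::finite, 'c) pepa \<Rightarrow> nat^'d \<Rightarrow> nat^'d \<Rightarrow> real" where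
  "jump_rate \<M> x y =
     (\<Sum>l | l \<in> labelled_activities \<M> \<and> real_state y = real_state x + transition_vec \<M> l.
        rate_fun \<M> (real_state x) l)"

definition reachable :: "('a, 'd::finite, 'c) pepa \<Rightarrow> nat^'d \<Rightarrow> (nat^'d) set" where
  "reachable \<M> x = {y. (\<lambda>u v. jump_rate \<M> u v > 0)\<^sup>*\<^sup>* x y}"

text \<open>The population size is conserved, so all the chains below have a finite state space.\<close>

lemma sum_transition_vec:
  fixes \<M> :: "('a, 'd::finite, 'c) pepa"
  shows "(\<Sum>P\<in>UNIV. transition_vec \<M> l $ P) = 0"
proof -
  have ax: "(\<Sum>P\<in>UNIV. (axis Q (1::real) :: real^'d) $ P) = 1" for Q
    by (simp add: axis_def)
  show ?thesis
  proof (cases l)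
    case (Indiv \<alpha> P Q)
    then show ?thesis by (simp add: sum_subtractf ax)
  next
    case (Shared \<alpha> w)
    have "(\<Sum>P\<in>UNIV. transition_vec \<M> l $ P) =
        (\<Sum>R\<in>enabling \<M> \<alpha>. \<Sum>P\<in>UNIV. (axis (w R) 1 - axis R 1 :: real^'d) $ P)"
      by (simp add: Shared sum.swap[of _ UNIV])
    then show ?thesis by (simp add: sum_subtractf ax)
  qed
qed

lemma finite_reachable:
  fixes \<M> :: "('a, 'd::finite, 'c) pepa"
  shows "finite (reachable \<M> x)"
proof -
  have step: "(\<Sum>P\<in>UNIV. v $ P) = (\<Sum>P\<in>UNIV. u $ P)" if "jump_rate \<M> u v > 0" for u v
  proof -
    have "{l. l \<in> labelled_activities \<M> \<and> real_state v = real_state u + transition_vec \<M> l} \<noteq> {}"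
      using that unfolding jump_rate_def by (metis (no_types, lifting) less_irrefl sum.empty)
    then obtain l where l: "real_state v = real_state u + transition_vec \<M> l" by blast
    have "(\<Sum>P\<in>UNIV. real_state v $ P) = (\<Sum>P\<in>UNIV. real_state u $ P)"
      unfolding l by (simp add: sum.distrib sum_transition_vec)
    then have "real (\<Sum>P\<in>UNIV. v $ P) = real (\<Sum>P\<in>UNIV. u $ P)"
      by (simp add: real_state_def)
    then show ?thesis by linarith
  qed
  have inv: "(\<Sum>P\<in>UNIV. y $ P) = (\<Sum>P\<in>UNIV. x $ P)" if "y \<in> reachable \<M> x" for y
  proof -
    have "(\<lambda>u v. jump_rate \<M> u v > 0)\<^sup>*\<^sup>* x y" using that by (simp add: reachable_def)
    then show ?thesis by (induction rule: rtranclp_induct) (auto dest: step)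
  qed
  let ?N = "\<Sum>P\<in>UNIV. x $ P"
  have "reachable \<M> x \<subseteq> vec_lambda ` (UNIV \<rightarrow>\<^sub>E {..?N})"
  proof
    fix y assume "y \<in> reachable \<M> x"
    from inv[OF this] have "y $ P \<le> ?N" for P
      by (metis UNIV_I finite_class.finite_UNIV member_le_sum zero_le)
    then show "y \<in> vec_lambda ` (UNIV \<rightarrow>\<^sub>E {..?N})"
      by (intro image_eqI[of _ _ "vec_nth y"]) auto
  qed
  moreover have "finite (vec_lambda ` ((UNIV :: 'd set) \<rightarrow>\<^sub>E {..?N}))"
    by (intro finite_imageI finite_PiE) auto
  ultimately show ?thesis by (rule finite_subset)
qed

text \<open>
  Continuous-time Markov chains on a finite state space \<open>S\<close> with jump rates \<open>q\<close> (only the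
  values \<open>q i j\<close> with \<open>i \<noteq> j\<close> matter): the transition function is the solution of Kolmogorov's
  backward equation, and the process has right-continuous paths (for the discrete topology on
  \<open>S\<close>) and the corresponding finite-dimensional distributions. The Markov property is stated
  with products instead of conditional probabilities, since the condition may have probability 0.
\<close>

definition generator :: "'s set \<Rightarrow> ('s \<Rightarrow> 's \<Rightarrow> real) \<Rightarrow> 's \<Rightarrow> 's \<Rightarrow> real" where
  "generator S q i j = (if i = j then - (\<Sum>k\<in>S - {i}. q i k) else q i j)"

definition transition_function ::
    "'s set \<Rightarrow> ('s \<Rightarrow> 's \<Rightarrow> real) \<Rightarrow> (real \<Rightarrow> 's \<Rightarrow> 's \<Rightarrow> real) \<Rightarrow> bool" where
  "transition_function S q p \<longleftrightarrow>
     (\<forall>i\<in>S. \<forall>j\<in>S. p 0 i j = (if i = j then 1 else 0) \<and>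
        (\<forall>t\<ge>0. ((\<lambda>t. p t i j) has_real_derivative (\<Sum>k\<in>S. generator S q i k * p t k j))
           (at t within {0..})))"

definition ctmc ::
    "'w measure \<Rightarrow> 's set \<Rightarrow> ('s \<Rightarrow> 's \<Rightarrow> real) \<Rightarrow> 's \<Rightarrow> (real \<Rightarrow> 'w \<Rightarrow> 's) \<Rightarrow> bool" where
  "ctmc M S q i0 X \<longleftrightarrow>
     prob_space M \<and>
     (\<forall>t\<ge>0. X t \<in> measurable M (count_space S)) \<and>
     (AE \<omega> in M. X 0 \<omega> = i0) \<and>
     (AE \<omega> in M. \<forall>t\<ge>0. \<forall>\<^sub>F s in at_right t. X s \<omega> = X t \<omega>) \<and>
     (\<exists>p. transition_function S q p \<and>
        (\<forall>(m::nat) (t :: nat \<Rightarrow> real) (i :: nat \<Rightarrow> 's).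
           0 \<le> t 0 \<and> (\<forall>k\<le>m. t k \<le> t (Suc k)) \<and> (\<forall>k\<le>Suc m. i k \<in> S) \<longrightarrow>
           measure M {\<omega> \<in> space M. \<forall>k\<le>Suc m. X (t k) \<omega> = i k} =
           measure M {\<omega> \<in> space M. \<forall>k\<le>m. X (t k) \<omega> = i k} *
             p (t (Suc m) - t m) (i m) (i (Suc m))))"

text \<open>
  The chains are only required to live on the same probability space; their joint distribution
  is arbitrary.
\<close>

definition density_dependent_ctmcs ::
    "'w measure \<Rightarrow> ('a, 'd::finite, 'c) pepa \<Rightarrow> nat^'d \<Rightarrow>
     (nat \<Rightarrow> real \<Rightarrow> 'w \<Rightarrow> nat^'d) \<Rightarrow> bool" where
  "density_dependent_ctmcs M \<M> x0 Xn \<longleftrightarrow>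
     (\<forall>n\<ge>1. let nx0 = (\<chi> P. n * x0 $ P)
       in ctmc M (reachable \<M> nx0) (jump_rate \<M>) nx0 (Xn n))"

end

theory Submission
  imports Defs
begin

text \<open>
  With \<open>V t x = \<parallel>x / n - X t\<parallel>\<^sup>4\<close>, the Lipschitz continuity of the rate functions and the scaling
  \<open>f (n z) l = n f z l\<close> give \<open>(\<partial>\<^sub>t + Q) V \<le> C (V + 1 / n\<^sup>2)\<close> for the generator \<open>Q\<close> of the
  \<open>n\<close>-th chain, so \<open>H t x = exp (- C t) V t x + C (T - t) / n\<^sup>2\<close> is a supersolution:
  \<open>(\<partial>\<^sub>t + Q) H \<le> 0\<close>. The maximal inequality for nonnegative supermartingales bounds the
  probability that \<open>H\<close> ever reaches the level \<open>a\<close> by \<open>C T / (a n\<^sup>2)\<close>. The fourth power makes this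
  bound summable in \<open>n\<close>, so that Borel--Cantelli applies whatever the joint distribution of the
  chains is.
\<close>

section \<open>Finite Markov chains\<close>

text \<open>The rows of the generator sum to zero, so it acts on \<open>g\<close> through
  differences alone. In this form its sign at a spatial minimum is evident, and jumps that leave
  \<open>g\<close> unchanged drop out.\<close>

lemma sum_generator:
  assumes "finite S" "i \<in> S"
  shows "(\<Sum>k\<in>S. generator S q i k * g k) = (\<Sum>k\<in>S - {i}. q i k * (g k - g i))"
proof -
  have "(\<Sum>k\<in>S. generator S q i k * g k)
      = generator S q i i * g i + (\<Sum>k\<in>S - {i}. generator S q i k * g k)"
    using assms by (simp add: sum.remove)
  also have "(\<Sum>k\<in>S - {i}. generator S q i k * g k) = (\<Sum>k\<in>S - {i}. q i k * g k)"
    by (intro sum.cong) (auto simp: generator_def)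
  finally show ?thesis
    by (simp add: generator_def right_diff_distrib sum_subtractf sum_distrib_right)
qed

text \<open>
  A spatial minimum of \<open>w t i + e * t\<close> at a positive time would have both a nonnegative generator
  term and a nonpositive left derivative.
\<close>

lemma minimum_principle:
  fixes w w' :: "real \<Rightarrow> 's \<Rightarrow> real"
  assumes S: "finite S" and q: "\<And>i j. i \<in> S \<Longrightarrow> j \<in> S \<Longrightarrow> q i j \<ge> 0"
    and w: "\<And>t i. 0 \<le> t \<Longrightarrow> t \<le> R \<Longrightarrow> i \<in> S \<Longrightarrow>
      ((\<lambda>t. w t i) has_real_derivative w' t i) (at t within {0..R})"
    and super: "\<And>t i. 0 \<le> t \<Longrightarrow> t \<le> R \<Longrightarrow> i \<in> S \<Longrightarrow>
      (\<Sum>k\<in>S. generator S q i k * w t k) \<le> w' t i"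
    and init: "\<And>i. i \<in> S \<Longrightarrow> 0 \<le> w 0 i"
    and t: "0 \<le> t" "t \<le> R" and i: "i \<in> S"
  shows "0 \<le> w t i"
proof -
  have R: "0 \<le> R" using t by linarith
  have bound: "0 \<le> w t i + e * t" if e: "e > 0" for e
  proof -
    have cont: "continuous_on {0..R} (\<lambda>s. w s j + e * s)" if "j \<in> S" for j
      by (intro continuous_intros DERIV_continuous_on[OF w]) (use that in auto)
    have "\<exists>s\<in>{0..R}. \<forall>s'\<in>{0..R}. w s j + e * s \<le> w s' j + e * s'" if "j \<in> S" for j
      by (rule continuous_attains_inf[OF _ _ cont]) (use R that in auto)
    then obtain \<sigma> where \<sigma>: "\<And>j. j \<in> S \<Longrightarrow> \<sigma> j \<in> {0..R}"
      "\<And>j s. j \<in> S \<Longrightarrow> s \<in> {0..R} \<Longrightarrow> w (\<sigma> j) j + e * \<sigma> j \<le> w s j + e * s"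
      by metis
    obtain j where j: "j \<in> S"
      and jmin: "\<And>k. k \<in> S \<Longrightarrow> w (\<sigma> j) j + e * \<sigma> j \<le> w (\<sigma> k) k + e * \<sigma> k"
    proof -
      have "S \<noteq> {}" using i by auto
      from arg_min_if_finite[OF S this, of "\<lambda>k. w (\<sigma> k) k + e * \<sigma> k"] show ?thesis
        using that by (meson not_le)
    qed
    define s where "s = \<sigma> j"
    have s: "0 \<le> s" "s \<le> R" using \<sigma>(1)[OF j] by (auto simp: s_def)
    have min: "w s j + e * s \<le> w s' k + e * s'" if "k \<in> S" "s' \<in> {0..R}" for k s'
      using jmin[OF that(1)] \<sigma>(2)[OF that] by (simp add: s_def)
    have "s = 0"
    proof (rule ccontr)
      assume "s \<noteq> 0"
      then have "0 < s" using s by simp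
      have "0 \<le> (\<Sum>k\<in>S - {j}. q j k * (w s k - w s j))"
        by (intro sum_nonneg mult_nonneg_nonneg) (use q j min[of _ s] s in auto)
      also have "\<dots> \<le> w' s j"
        using super[OF s j] by (simp add: sum_generator[OF S j])
      finally have "0 < w' s j + e" using e by simp
      moreover have "((\<lambda>s. w s j + e * s) has_real_derivative w' s j + e) (at s within {0..R})"
        by (auto intro!: derivative_eq_intros w j s)
      ultimately obtain d where d: "d > 0"
        "\<And>h. 0 < h \<Longrightarrow> s - h \<in> {0..R} \<Longrightarrow> h < d \<Longrightarrow> w (s - h) j + e * (s - h) < w s j + e * s"
        using has_real_derivative_pos_inc_left by blast
      \<comment> \<open>Halving \<open>d\<close> keeps \<open>h\<close> strictly below it; the cap
        \<open>s\<close> keeps \<open>s - h\<close> inside the time interval, where \<open>s\<close>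
        is a minimiser.\<close>
      define h where "h = min (d/2) s"
      have "0 < h" "h < d" "h \<le> s" using d \<open>0 < s\<close> by (auto simp: h_def)
      then show False using d(2)[of h] min[OF j, of "s - h"] s by auto
    qed
    then have "0 \<le> w s j + e * s" using init[OF j] by simp
    also have "\<dots> \<le> w t i + e * t" using min[OF i] t by simp
    finally show ?thesis .
  qed
  show ?thesis
  proof (rule field_le_epsilon)
    fix e :: real assume "e > 0"
    \<comment> \<open>Dividing by \<open>t + 1\<close> instead of \<open>t\<close> also covers
      \<open>t = 0\<close>.\<close>
    then have "e / (t + 1) * t \<le> e" using t by (simp add: field_simps)
    then show "0 \<le> w t i + e"
      using bound[of "e / (t + 1)"] t \<open>e > 0\<close> by simp
  qed
qed

text \<open>
  The minimum principle is applied to \<open>H (u - r) i - (\<Sum>j\<in>S. p r i j * H u j)\<close> as a function of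
  \<open>r\<close>, which needs only the backward equation.
\<close>

lemma transition_function_supersolution:
  fixes H H' :: "real \<Rightarrow> 's \<Rightarrow> real"
  assumes S: "finite S" and q: "\<And>i j. i \<in> S \<Longrightarrow> j \<in> S \<Longrightarrow> q i j \<ge> 0"
    and p: "transition_function S q p"
    and H: "\<And>t i. 0 \<le> t \<Longrightarrow> t \<le> T \<Longrightarrow> i \<in> S \<Longrightarrow>
      ((\<lambda>t. H t i) has_real_derivative H' t i) (at t within {0..T})"
    and super: "\<And>t i. 0 \<le> t \<Longrightarrow> t \<le> T \<Longrightarrow> i \<in> S \<Longrightarrow>
      H' t i + (\<Sum>k\<in>S. generator S q i k * H t k) \<le> 0"
    and s: "0 \<le> s" "s \<le> u" "u \<le> T" and i: "i \<in> S"
  shows "(\<Sum>j\<in>S. p (u - s) i j * H u j) \<le> H s i"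
proof -
  let ?w = "\<lambda>r i. H (u - r) i - (\<Sum>j\<in>S. p r i j * H u j)"
  let ?w' = "\<lambda>r i. - H' (u - r) i - (\<Sum>j\<in>S. (\<Sum>k\<in>S. generator S q i k * p r k j) * H u j)"
  have "0 \<le> ?w (u - s) i"
  proof (rule minimum_principle[OF S q, where R="u - s" and w="?w" and w'="?w'"])
    fix r i assume r: "0 \<le> r" "r \<le> u - s" and i: "i \<in> S"
    \<comment> \<open>The reversal \<open>u - r\<close> turns the terminal value problem for
      \<open>H\<close> into an initial value problem, at the price of a factor -1.\<close>
    have "((\<lambda>r. H (u - r) i) has_real_derivative H' (u - r) i * (- 1)) (at r within {0..u - s})"
    proof (rule DERIV_image_chain[where g="\<lambda>r. u - r" and f="\<lambda>t. H t i", unfolded o_def])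
      show "((\<lambda>t. H t i) has_real_derivative H' (u - r) i)
          (at (u - r) within (\<lambda>r. u - r) ` {0..u - s})"
        by (rule has_field_derivative_subset[OF H]) (use r s i in auto)
      show "((\<lambda>r. u - r) has_real_derivative - 1) (at r within {0..u - s})"
        by (auto intro!: derivative_eq_intros)
    qed
    moreover have "((\<lambda>r. p r i j) has_real_derivative (\<Sum>k\<in>S. generator S q i k * p r k j))
        (at r within {0..u - s})" if "j \<in> S" for j
      using p i that r unfolding transition_function_def
      by (auto intro!: has_field_derivative_subset[where s="{0..}" and t="{0..u - s}"])
    ultimately show "((\<lambda>r. ?w r i) has_real_derivative ?w' r i) (at r within {0..u - s})"
      by (auto intro!: derivative_eq_intros sum.cong)
    have "(\<Sum>k\<in>S. generator S q i k * ?w r k)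
        = (\<Sum>k\<in>S. generator S q i k * H (u - r) k)
          - (\<Sum>k\<in>S. \<Sum>j\<in>S. generator S q i k * p r k j * H u j)"
      by (simp add: right_diff_distrib sum_subtractf sum_distrib_left mult.assoc)
    also have "(\<Sum>k\<in>S. \<Sum>j\<in>S. generator S q i k * p r k j * H u j)
        = (\<Sum>j\<in>S. (\<Sum>k\<in>S. generator S q i k * p r k j) * H u j)"
      by (subst sum.swap) (simp add: sum_distrib_right)
    finally show "(\<Sum>k\<in>S. generator S q i k * ?w r k) \<le> ?w' r i"
      using super[of "u - r" i] r s i by simp
  next
    fix i assume i: "i \<in> S"
    \<comment> \<open>\<open>p 0\<close> is the identity matrix, so the difference starts exactly at
      0.\<close>
    have "(\<Sum>j\<in>S. p 0 i j * H u j) = (\<Sum>j\<in>S. if i = j then H u j else 0)"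
      using p i by (intro sum.cong) (auto simp: transition_function_def)
    then show "0 \<le> ?w 0 i"
      using S i by simp
  qed (use s i in auto)
  then show ?thesis by simp
qed

section \<open>Maximal inequality along finite and dyadic time grids\<close>

lemma ctmc_measurable_pred:
  assumes "ctmc M S q i0 X" "0 \<le> t"
  shows "Measurable.pred M (\<lambda>\<omega>. Q (X t \<omega>))"
proof -
  have "X t \<in> measurable M (count_space S)" using assms by (simp add: ctmc_def)
  then show ?thesis by (rule measurable_compose) simp
qed

text \<open>The maximal inequality for nonnegative supermartingales: one stops at the first grid
  time at which the level \<open>a\<close> is reached, and the expectation of \<open>H\<close>
  cannot increase until then.\<close>

lemma ctmc_grid_maximal:
  fixes H H' :: "real \<Rightarrow> 's \<Rightarrow> real" and \<tau> :: "nat \<Rightarrow> real"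
  assumes X: "ctmc M S q i0 X" and S: "finite S" and i0: "i0 \<in> S"
    and q: "\<And>i j. i \<in> S \<Longrightarrow> j \<in> S \<Longrightarrow> q i j \<ge> 0"
    and H: "\<And>t i. 0 \<le> t \<Longrightarrow> t \<le> T \<Longrightarrow> i \<in> S \<Longrightarrow>
      ((\<lambda>t. H t i) has_real_derivative H' t i) (at t within {0..T})"
    and super: "\<And>t i. 0 \<le> t \<Longrightarrow> t \<le> T \<Longrightarrow> i \<in> S \<Longrightarrow>
      H' t i + (\<Sum>k\<in>S. generator S q i k * H t k) \<le> 0"
    and nonneg: "\<And>t i. 0 \<le> t \<Longrightarrow> t \<le> T \<Longrightarrow> i \<in> S \<Longrightarrow> 0 \<le> H t i"
    and a: "0 \<le> a"
    and \<tau>: "mono \<tau>" "\<tau> 0 = 0" "\<tau> N \<le> T"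
  shows "a * measure M {\<omega> \<in> space M. \<exists>k\<le>N. a \<le> H (\<tau> k) (X (\<tau> k) \<omega>)} \<le> H 0 i0"
proof -
  obtain p where p: "transition_function S q p"
    and markov: "\<And>(m::nat) (t :: nat \<Rightarrow> real) i. 0 \<le> t 0 \<Longrightarrow> (\<forall>k\<le>m. t k \<le> t (Suc k)) \<Longrightarrow>
      (\<forall>k\<le>Suc m. i k \<in> S) \<Longrightarrow>
           measure M {\<omega> \<in> space M. \<forall>k\<le>Suc m. X (t k) \<omega> = i k} =
           measure M {\<omega> \<in> space M. \<forall>k\<le>m. X (t k) \<omega> = i k} *
             p (t (Suc m) - t m) (i m) (i (Suc m))"
    using X unfolding ctmc_def by blast
  interpret prob_space M using X by (simp add: ctmc_def)
  have \<tau>0: "0 \<le> \<tau> k" for k using monoD[OF \<tau>(1), of 0 k] \<tau>(2) by simp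
  have \<tau>T: "\<tau> k \<le> T" if "k \<le> N" for k using monoD[OF \<tau>(1) that] \<tau>(3) by simp
  have [measurable]: "Measurable.pred M (\<lambda>\<omega>. Q (X (\<tau> k) \<omega>))" for k Q
    by (rule ctmc_measurable_pred[OF X \<tau>0])
  define path where "path k i = {\<omega> \<in> space M. \<forall>j\<le>k. X (\<tau> j) \<omega> = i j}" for k and i :: "nat \<Rightarrow> 's"
  define hit where "hit k r = {\<omega> \<in> space M. \<exists>j\<in>{k..k + r}. a \<le> H (\<tau> j) (X (\<tau> j) \<omega>)}" for k r
  have [measurable]: "path k i \<in> sets M" "hit k r \<in> sets M" for k i r
    unfolding path_def hit_def by measurable
  \<comment> \<open>Conditioning on a whole initial path and inducting on the number \<open>r\<close> of remaining steps
    avoids conditional expectations.\<close>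
  have path_hit: "a * prob (path k i \<inter> hit k r) \<le> prob (path k i) * H (\<tau> k) (i k)"
    if "k + r \<le> N" "\<forall>j\<le>k. i j \<in> S" for k r i
    using that
  proof (induction r arbitrary: k i)
    case 0
    have H0: "0 \<le> H (\<tau> k) (i k)" by (rule nonneg) (use 0 \<tau>0 \<tau>T in auto)
    show ?case
    proof (cases "a \<le> H (\<tau> k) (i k)")
      case True
      then have "a * prob (path k i \<inter> hit k 0) \<le> H (\<tau> k) (i k) * prob (path k i)"
        by (intro mult_mono finite_measure_mono) (use H0 in auto)
      then show ?thesis by (simp add: mult.commute)
    next
      case False
      then have "path k i \<inter> hit k 0 = {}" by (auto simp: path_def hit_def)
      then show ?thesis using H0 by simp
    qed
  next
    case (Suc r)
    have H0: "0 \<le> H (\<tau> k) (i k)" by (rule nonneg) (use Suc.prems \<tau>0 \<tau>T in auto)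
    show ?case
    proof (cases "a \<le> H (\<tau> k) (i k)")
      \<comment> \<open>Stopping takes place at index \<open>k\<close>, so it suffices to bound the
        event by the path alone.\<close>
      case True
      then have "a * prob (path k i \<inter> hit k (Suc r)) \<le> H (\<tau> k) (i k) * prob (path k i)"
        by (intro mult_mono finite_measure_mono) (use H0 in auto)
      then show ?thesis by (simp add: mult.commute)
    next
      case False
      \<comment> \<open>Any hit must come after \<open>k\<close>. The path is prolonged by each
        possible next value \<open>y\<close>; the induction hypothesis, the Markov property and the
        supersolution property then remove one step.\<close>
      let ?i = "\<lambda>y. i(Suc k := y)"
      have "path k i \<inter> hit k (Suc r) \<subseteq> (\<Union>y\<in>S. path (Suc k) (?i y) \<inter> hit (Suc k) r)"
      proof
        fix \<omega> assume \<omega>: "\<omega> \<in> path k i \<inter> hit k (Suc r)"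
        then obtain j where j: "k \<le> j" "j \<le> k + Suc r" "a \<le> H (\<tau> j) (X (\<tau> j) \<omega>)"
          by (auto simp: hit_def)
        have "j \<noteq> k" using False j \<omega> by (auto simp: path_def)
        then have "\<omega> \<in> hit (Suc k) r" using j \<omega> by (auto simp: hit_def intro!: bexI[of _ j])
        moreover have "\<omega> \<in> path (Suc k) (?i (X (\<tau> (Suc k)) \<omega>))"
          using \<omega> by (auto simp: path_def le_Suc_eq)
        moreover have "X (\<tau> (Suc k)) \<omega> \<in> S"
          using X \<tau>0[of "Suc k"] \<omega> by (auto simp: ctmc_def path_def dest!: measurable_space)
        ultimately show "\<omega> \<in> (\<Union>y\<in>S. path (Suc k) (?i y) \<inter> hit (Suc k) r)" by blast
      qed
      then have "prob (path k i \<inter> hit k (Suc r))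
          \<le> prob (\<Union>y\<in>S. path (Suc k) (?i y) \<inter> hit (Suc k) r)"
        by (rule finite_measure_mono) (intro sets.finite_UN S, measurable)
      also have "\<dots> \<le> (\<Sum>y\<in>S. prob (path (Suc k) (?i y) \<inter> hit (Suc k) r))"
        by (rule finite_measure_subadditive_finite) (use S in auto)
      finally have "a * prob (path k i \<inter> hit k (Suc r))
          \<le> a * (\<Sum>y\<in>S. prob (path (Suc k) (?i y) \<inter> hit (Suc k) r))"
        using a by (rule mult_left_mono)
      also have "\<dots> = (\<Sum>y\<in>S. a * prob (path (Suc k) (?i y) \<inter> hit (Suc k) r))"
        by (simp add: sum_distrib_left)
      also have "\<dots> \<le> (\<Sum>y\<in>S. prob (path (Suc k) (?i y)) * H (\<tau> (Suc k)) (?i y (Suc k)))"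
        by (intro sum_mono Suc.IH) (use Suc.prems in auto)
      also have "\<dots> = (\<Sum>y\<in>S. prob (path k i) * p (\<tau> (Suc k) - \<tau> k) (i k) y * H (\<tau> (Suc k)) y)"
      proof (intro sum.cong refl)
        fix y assume y: "y \<in> S"
        have "prob (path (Suc k) (?i y))
            = prob (path k (?i y)) * p (\<tau> (Suc k) - \<tau> k) (?i y k) (?i y (Suc k))"
          unfolding path_def
          by (rule markov) (use y Suc.prems \<tau>0 monoD[OF \<tau>(1)] in auto)
        \<comment> \<open>The event \<open>path k\<close> does not look at index
          \<open>Suc k\<close>, the only place where \<open>?i y\<close> and \<open>i\<close> can
          differ.\<close>
        moreover have "path k (?i y) = path k i" by (auto simp: path_def)
        ultimately show "prob (path (Suc k) (?i y)) * H (\<tau> (Suc k)) (?i y (Suc k))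
            = prob (path k i) * p (\<tau> (Suc k) - \<tau> k) (i k) y * H (\<tau> (Suc k)) y" by simp
      qed
      also have "\<dots> = prob (path k i) * (\<Sum>y\<in>S. p (\<tau> (Suc k) - \<tau> k) (i k) y * H (\<tau> (Suc k)) y)"
        by (simp add: sum_distrib_left mult.assoc)
      also have "\<dots> \<le> prob (path k i) * H (\<tau> k) (i k)"
        by (intro mult_left_mono transition_function_supersolution[OF S q p H super])
          (use Suc.prems \<tau>0 \<tau>T monoD[OF \<tau>(1)] in auto)
      finally show ?thesis .
    qed
  qed
  \<comment> \<open>The chain starts in \<open>i0\<close> only almost surely, so restricting to the
    path of length 0 is an equality up to a null set.\<close>
  have "AE \<omega> in M. X (\<tau> 0) \<omega> = i0" using X \<tau>(2) by (simp add: ctmc_def)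
  then have "prob {\<omega> \<in> space M. \<exists>k\<le>N. a \<le> H (\<tau> k) (X (\<tau> k) \<omega>)}
      = prob (path 0 (\<lambda>_. i0) \<inter> hit 0 N)"
    by (intro finite_measure_eq_AE) (auto simp: path_def hit_def elim!: eventually_mono)
  moreover have "a * prob (path 0 (\<lambda>_. i0) \<inter> hit 0 N) \<le> prob (path 0 (\<lambda>_. i0)) * H 0 i0"
    using path_hit[of 0 N "\<lambda>_. i0"] i0 \<tau>(2) by simp
  moreover have "\<dots> \<le> 1 * H 0 i0"
    by (intro mult_right_mono prob_le_1 nonneg) (use i0 \<tau>T[of 0] \<tau>(2) in auto)
  ultimately show ?thesis by simp
qed

text \<open>Each dyadic grid refines the preceding one, so the hitting events increase with
  \<open>m\<close>. The bound does not depend on the grid and passes to their union by continuity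
  from below.\<close>

lemma ctmc_dyadic_maximal:
  fixes H H' :: "real \<Rightarrow> 's \<Rightarrow> real"
  assumes X: "ctmc M S q i0 X" and S: "finite S" and i0: "i0 \<in> S"
    and q: "\<And>i j. i \<in> S \<Longrightarrow> j \<in> S \<Longrightarrow> q i j \<ge> 0"
    and H: "\<And>t i. 0 \<le> t \<Longrightarrow> t \<le> T \<Longrightarrow> i \<in> S \<Longrightarrow>
      ((\<lambda>t. H t i) has_real_derivative H' t i) (at t within {0..T})"
    and super: "\<And>t i. 0 \<le> t \<Longrightarrow> t \<le> T \<Longrightarrow> i \<in> S \<Longrightarrow>
      H' t i + (\<Sum>k\<in>S. generator S q i k * H t k) \<le> 0"
    and nonneg: "\<And>t i. 0 \<le> t \<Longrightarrow> t \<le> T \<Longrightarrow> i \<in> S \<Longrightarrow> 0 \<le> H t i"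
    and a: "0 \<le> a" and T: "0 \<le> T"
  defines "B \<equiv> {\<omega> \<in> space M. \<exists>m. \<exists>k\<le>2 ^ m.
      a \<le> H (T * real k / 2 ^ m) (X (T * real k / 2 ^ m) \<omega>)}"
  shows "B \<in> sets M" and "a * measure M B \<le> H 0 i0"
proof -
  interpret prob_space M using X by (simp add: ctmc_def)
  define A where "A m = {\<omega> \<in> space M. \<exists>k\<le>2 ^ m.
      a \<le> H (T * real k / 2 ^ m) (X (T * real k / 2 ^ m) \<omega>)}" for m :: nat
  have [measurable]: "Measurable.pred M (\<lambda>\<omega>. Q (X (T * real k / 2 ^ m) \<omega>))" for k m Q
    by (rule ctmc_measurable_pred[OF X]) (use T in auto)
  have A[measurable]: "A m \<in> sets M" for m unfolding A_def by measurable
  have B: "B = (\<Union>m. A m)" by (auto simp: B_def A_def)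
  show "B \<in> sets M" unfolding B by measurable
  have "A m \<subseteq> A (Suc m)" for m
  proof
    fix \<omega> assume "\<omega> \<in> A m"
    then obtain k where "k \<le> 2 ^ m" "a \<le> H (T * real k / 2 ^ m) (X (T * real k / 2 ^ m) \<omega>)"
      "\<omega> \<in> space M" by (auto simp: A_def)
    moreover have "T * real (2 * k) / 2 ^ Suc m = T * real k / 2 ^ m" by simp
    ultimately show "\<omega> \<in> A (Suc m)"
      unfolding A_def by (intro CollectI conjI exI[of _ "2 * k"]) (simp_all only:, auto)
  qed
  then have "incseq A" by (rule incseq_SucI)
  then have "(\<lambda>m. prob (A m)) \<longlonglongrightarrow> prob B"
    unfolding B using A by (intro finite_Lim_measure_incseq) auto
  then have "(\<lambda>m. a * prob (A m)) \<longlonglongrightarrow> a * prob B" by (intro tendsto_intros)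
  moreover have "a * prob (A m) \<le> H 0 i0" for m
    unfolding A_def
    by (rule ctmc_grid_maximal[OF X S i0 q H super nonneg a])
      (use T in \<open>auto intro!: monoI divide_right_mono mult_left_mono\<close>)
  ultimately show "a * measure M B \<le> H 0 i0"
    using LIMSEQ_le_const2 by blast
qed

section \<open>Rates of a PEPA model\<close>

lemma finite_labelled_activities:
  fixes \<M> :: "('a, 'd::finite, 'c) pepa"
  assumes "pepa_model \<M>"
  shows "finite (labelled_activities \<M>)"
proof -
  have act: "finite (actions \<M>)" "finite (shared \<M>)"
    using assms unfolding pepa_model_def by (blast intro: finite_subset)+
  have "labelled_activities \<M> \<subseteq> (\<lambda>(\<alpha>, P, Q). Indiv \<alpha> P Q) ` (actions \<M> \<times> UNIV) \<union>
      (\<Union>\<alpha>\<in>shared \<M>. Shared \<alpha> ` (\<Pi>\<^sub>E P\<in>enabling \<M> \<alpha>. post \<M> P \<alpha>))"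
    by (auto simp: labelled_activities_def image_iff)
  moreover have "finite \<dots>"
    using act by (auto intro!: finite_PiE)
  ultimately show ?thesis by (rule finite_subset)
qed

lemma apparent_rate_pos:
  assumes "pepa_model \<M>" "\<alpha> \<in> actions \<M>" "P \<in> enabling \<M> \<alpha>"
  shows "0 < apparent_rate \<M> \<alpha> P"
proof -
  obtain Q where "0 < trate \<M> \<alpha> P Q" using assms(3) by (auto simp: enabling_def post_def)
  then show ?thesis
    unfolding apparent_rate_def using assms(1,2) by (auto simp: pepa_model_def intro!: sum_pos2[of _ Q])
qed

text \<open>This case rule collects the sign conditions on which the later facts about rates rest: a
  minimum over a nonempty set, positive apparent rates and a nonnegative prefactor.\<close>

lemma labelled_activities_cases:
  assumes "pepa_model \<M>" "l \<in> labelled_activities \<M>"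
  obtains (Indiv) \<alpha> P Q where "l = Indiv \<alpha> P Q" "\<alpha> \<in> actions \<M>" "0 < trate \<M> \<alpha> P Q"
  | (Shared) \<alpha> w where "l = Shared \<alpha> w" "enabling \<M> \<alpha> \<noteq> {}"
      "\<And>P. P \<in> enabling \<M> \<alpha> \<Longrightarrow> 0 < apparent_rate \<M> \<alpha> P"
      "0 \<le> (\<Prod>P\<in>enabling \<M> \<alpha>. trate \<M> \<alpha> P (w P) / apparent_rate \<M> \<alpha> P)"
proof (cases l)
  case (Indiv \<alpha> P Q)
  show ?thesis
    by (rule that(1)[OF Indiv]) (use Indiv assms(2) in \<open>auto simp: labelled_activities_def post_def\<close>)
next
  case (Shared \<alpha> w)
  then have "\<alpha> \<in> shared \<M>" using assms(2) by (auto simp: labelled_activities_def)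
  then have \<alpha>: "\<alpha> \<in> actions \<M>" and E: "enabling \<M> \<alpha> \<noteq> {}"
    using assms(1) unfolding pepa_model_def by blast+
  have pos: "0 < apparent_rate \<M> \<alpha> P" if "P \<in> enabling \<M> \<alpha>" for P
    by (rule apparent_rate_pos[OF assms(1) \<alpha> that])
  have "0 \<le> trate \<M> \<alpha> P Q" for P Q
    using assms(1) \<alpha> unfolding pepa_model_def by blast
  then have "0 \<le> (\<Prod>P\<in>enabling \<M> \<alpha>. trate \<M> \<alpha> P (w P) / apparent_rate \<M> \<alpha> P)"
    by (intro prod_nonneg divide_nonneg_pos pos)
  with E pos show ?thesis by (rule that(2)[OF Shared])
qed

lemma rate_fun_nonneg:
  assumes "pepa_model \<M>" "l \<in> labelled_activities \<M>" "\<And>P. 0 \<le> z $ P"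
  shows "0 \<le> rate_fun \<M> z l"
  using assms(1,2)
proof (cases rule: labelled_activities_cases)
  case (Indiv \<alpha> P Q)
  then show ?thesis using assms(3) by simp
next
  case (Shared \<alpha> w)
  then show ?thesis
    using assms(3) by (auto simp: less_imp_le intro!: mult_nonneg_nonneg)
qed

text \<open>A minimum commutes with multiplication by a nonnegative number. The factor
  \<open>c = n\<close> expresses the density dependence of the rates, and \<open>c = 0\<close> shows
  that they vanish at the origin.\<close>

lemma rate_fun_scaleR:
  assumes "pepa_model \<M>" "l \<in> labelled_activities \<M>" "0 \<le> c"
  shows "rate_fun \<M> (c *\<^sub>R z) l = c * rate_fun \<M> z l"
  using assms(1,2)
proof (cases rule: labelled_activities_cases)
  case (Shared \<alpha> w)
  have "Min ((\<lambda>P. c * (z $ P * apparent_rate \<M> \<alpha> P)) ` enabling \<M> \<alpha>)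
      = c * Min ((\<lambda>P. z $ P * apparent_rate \<M> \<alpha> P) ` enabling \<M> \<alpha>)"
    using mono_Min_commute[of "(*) c" "(\<lambda>P. z $ P * apparent_rate \<M> \<alpha> P) ` enabling \<M> \<alpha>"]
      Shared assms(3) by (simp add: monoI mult_left_mono image_image)
  then show ?thesis using Shared by (simp add: mult_ac)
qed simp

lemma abs_Min_diff_le:
  fixes f g :: "'b \<Rightarrow> real"
  assumes A: "finite A" "A \<noteq> {}" and c: "\<And>a. a \<in> A \<Longrightarrow> \<bar>f a - g a\<bar> \<le> c"
  shows "\<bar>Min (f ` A) - Min (g ` A)\<bar> \<le> c"
proof -
  have "Min (f ` A) - c \<le> Min (g ` A)"
    if c: "\<And>a. a \<in> A \<Longrightarrow> \<bar>f a - g a\<bar> \<le> c" for f g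
  proof -
    have "Min (f ` A) - c \<le> g a" if "a \<in> A" for a
    proof -
      have "Min (f ` A) \<le> f a" using A that by (intro Min_le) auto
      then show ?thesis using c[OF that] by linarith
    qed
    then show ?thesis using A by simp
  qed
  from this[of f g] this[of g f] c show ?thesis
    by (fastforce simp: abs_minus_commute abs_le_iff)
qed

text \<open>An individual rate is linear, a shared one a multiple of a minimum of linear functions.
  The bound is global because the solution of the ODEs enters without a sign condition on its
  coordinates.\<close>

lemma rate_fun_lipschitz:
  assumes "pepa_model \<M>" "l \<in> labelled_activities \<M>"
  shows "\<exists>L\<ge>0. \<forall>z z'. \<bar>rate_fun \<M> z l - rate_fun \<M> z' l\<bar> \<le> L * norm (z - z')"
  using assms
proof (cases rule: labelled_activities_cases)
  case (Indiv \<alpha> P Q)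
  have "\<bar>rate_fun \<M> z l - rate_fun \<M> z' l\<bar> \<le> trate \<M> \<alpha> P Q * norm (z - z')" for z z'
    using Indiv component_le_norm_cart[of "z - z'" P]
    by (simp add: left_diff_distrib[symmetric] abs_mult mult.commute)
  then show ?thesis using Indiv by (intro exI[of _ "trate \<M> \<alpha> P Q"]) auto
next
  case (Shared \<alpha> w)
  define c where "c = (\<Sum>P\<in>enabling \<M> \<alpha>. apparent_rate \<M> \<alpha> P)"
  have c0: "0 \<le> c" using Shared(3) by (auto simp: c_def less_imp_le intro!: sum_nonneg)
  have "\<bar>z $ P * apparent_rate \<M> \<alpha> P - z' $ P * apparent_rate \<M> \<alpha> P\<bar> \<le> c * norm (z - z')"
    if P: "P \<in> enabling \<M> \<alpha>" for P z z'
  proof -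
    have "\<bar>z $ P * apparent_rate \<M> \<alpha> P - z' $ P * apparent_rate \<M> \<alpha> P\<bar>
        = apparent_rate \<M> \<alpha> P * \<bar>(z - z') $ P\<bar>"
      using Shared(3)[OF P] by (simp add: left_diff_distrib[symmetric] abs_mult mult.commute)
    also have "\<dots> \<le> c * norm (z - z')"
      unfolding c_def
      by (intro mult_mono component_le_norm_cart member_le_sum sum_nonneg)
        (use P Shared(3) in \<open>auto simp: less_imp_le\<close>)
    finally show ?thesis .
  qed
  then have Min: "\<bar>Min ((\<lambda>P. z $ P * apparent_rate \<M> \<alpha> P) ` enabling \<M> \<alpha>) -
      Min ((\<lambda>P. z' $ P * apparent_rate \<M> \<alpha> P) ` enabling \<M> \<alpha>)\<bar> \<le> c * norm (z - z')" for z z'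
    by (intro abs_Min_diff_le) (use Shared(2) in auto)
  define \<pi> where "\<pi> = (\<Prod>P\<in>enabling \<M> \<alpha>. trate \<M> \<alpha> P (w P) / apparent_rate \<M> \<alpha> P)"
  have "\<bar>rate_fun \<M> z l - rate_fun \<M> z' l\<bar> \<le> \<pi> * c * norm (z - z')" for z z'
    using mult_left_mono[OF Min[of z z'], of \<pi>] Shared(1,4)
    by (simp add: \<pi>_def[symmetric] right_diff_distrib[symmetric] abs_mult mult.assoc)
  moreover have "0 \<le> \<pi> * c" using c0 Shared(4) by (simp add: \<pi>_def)
  ultimately show ?thesis by blast
qed

lemma rate_fun_uniform_bounds:
  fixes \<M> :: "('a, 'd::finite, 'c) pepa"
  assumes "pepa_model \<M>"
  obtains L where "0 \<le> L"
    "\<And>l z z'. l \<in> labelled_activities \<M> \<Longrightarrow> \<bar>rate_fun \<M> z l - rate_fun \<M> z' l\<bar> \<le> L * norm (z - z')"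
    "\<And>l z. l \<in> labelled_activities \<M> \<Longrightarrow> rate_fun \<M> z l \<le> L * norm z"
    "\<And>l. l \<in> labelled_activities \<M> \<Longrightarrow> norm (transition_vec \<M> l) \<le> L"
proof -
  obtain \<Lambda> where \<Lambda>: "\<And>l. l \<in> labelled_activities \<M> \<Longrightarrow> 0 \<le> \<Lambda> l"
    "\<And>l z z'. l \<in> labelled_activities \<M> \<Longrightarrow> \<bar>rate_fun \<M> z l - rate_fun \<M> z' l\<bar> \<le> \<Lambda> l * norm (z - z')"
    using rate_fun_lipschitz[OF assms] by metis
  \<comment> \<open>A sum over the finitely many activities dominates each Lipschitz constant and
    each transition vector at once.\<close>
  define L where "L = (\<Sum>l\<in>labelled_activities \<M>. \<Lambda> l + norm (transition_vec \<M> l))"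
  have le: "\<Lambda> l + norm (transition_vec \<M> l) \<le> L" if "l \<in> labelled_activities \<M>" for l
    unfolding L_def
    by (rule member_le_sum) (use that finite_labelled_activities[OF assms] \<Lambda>(1) in auto)
  have \<Lambda>L: "\<Lambda> l \<le> L" if "l \<in> labelled_activities \<M>" for l
    using le[OF that] norm_ge_zero[of "transition_vec \<M> l"] by linarith
  have lip: "\<bar>rate_fun \<M> z l - rate_fun \<M> z' l\<bar> \<le> L * norm (z - z')"
    if "l \<in> labelled_activities \<M>" for l z z'
    using \<Lambda>(2)[OF that, of z z'] mult_right_mono[OF \<Lambda>L[OF that], of "norm (z - z')"] by simp
  show ?thesis
  proof (rule that)
    show "0 \<le> L" unfolding L_def using \<Lambda>(1) by (intro sum_nonneg) auto
    show "rate_fun \<M> z l \<le> L * norm z" if l: "l \<in> labelled_activities \<M>" for l z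
      \<comment> \<open>Linear growth is the Lipschitz bound against the origin, where the rate
        vanishes by homogeneity.\<close>
      using lip[OF l, of z 0] rate_fun_scaleR[OF assms l, of 0 0] by simp
    show "norm (transition_vec \<M> l) \<le> L" if l: "l \<in> labelled_activities \<M>" for l
      using le[OF l] \<Lambda>(1)[OF l] by linarith
  qed (rule lip)
qed

section \<open>Jumps of the chain in terms of labelled activities\<close>

lemma jump_rate_nonneg: "pepa_model \<M> \<Longrightarrow> 0 \<le> jump_rate \<M> x y"
  unfolding jump_rate_def by (intro sum_nonneg rate_fun_nonneg) (auto simp: real_state_def)

lemma real_state_inject: "real_state x = real_state y \<longleftrightarrow> x = y"
  by (auto simp: real_state_def vec_eq_iff)

text \<open>A positive rate forces every local derivative in the pre set to be populated, so no
  coordinate of the target becomes negative.\<close>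

lemma transition_target:
  fixes \<M> :: "('a, 'd::finite, 'c) pepa"
  assumes \<M>: "pepa_model \<M>" and l: "l \<in> labelled_activities \<M>"
    and pos: "0 < rate_fun \<M> (real_state x) l"
  obtains y where "real_state y = real_state x + transition_vec \<M> l" "0 < jump_rate \<M> x y"
proof -
  have "\<exists>n. (real_state x + transition_vec \<M> l) $ R = real n" for R
    using \<M> l
  proof (cases rule: labelled_activities_cases)
    case (Indiv \<alpha> P Q)
    have "0 < real (x $ P) * trate \<M> \<alpha> P Q" using pos Indiv by (simp add: real_state_def)
    then have "1 \<le> x $ P" by (cases "x $ P = 0") auto
    then have "(real_state x + transition_vec \<M> l) $ R
        = real (x $ R - (if R = P then 1 else 0) + (if R = Q then 1 else 0))"
      using Indiv by (auto simp: real_state_def axis_def)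
    then show ?thesis by blast
  next
    case (Shared \<alpha> w)
    let ?E = "enabling \<M> \<alpha>"
    have pos_Min: "0 < Min ((\<lambda>P. real_state x $ P * apparent_rate \<M> \<alpha> P) ` ?E)"
      using pos Shared(1,4) by (auto simp: zero_less_mult_iff)
    have x: "1 \<le> x $ P" if "P \<in> ?E" for P
    proof -
      have "Min ((\<lambda>P. real_state x $ P * apparent_rate \<M> \<alpha> P) ` ?E)
          \<le> real_state x $ P * apparent_rate \<M> \<alpha> P"
        using that by (intro Min_le) auto
      with pos_Min show ?thesis by (cases "x $ P = 0") (auto simp: real_state_def)
    qed
    have "transition_vec \<M> l $ R
        = (\<Sum>P\<in>?E. if w P = R then 1 else 0) - (\<Sum>P\<in>?E. if P = R then 1 else 0)"
      using Shared(1) by (simp add: sum_subtractf axis_def eq_commute[of R])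
    also have "(\<Sum>P\<in>?E. if w P = R then 1 else 0) = real (card {P\<in>?E. w P = R})"
      by (simp add: sum.If_cases Int_def)
    also have "(\<Sum>P\<in>?E. if P = R then 1 else 0) = (if R \<in> ?E then 1 else 0 :: real)"
      by simp
    finally have "transition_vec \<M> l $ R
        = real (card {P\<in>?E. w P = R}) - (if R \<in> ?E then 1 else 0)" .
    \<comment> \<open>At most one unit is subtracted at \<open>R\<close>, and only where
      \<open>x\<close> provides one; so truncated subtraction on naturals is exact here.\<close>
    then have "(real_state x + transition_vec \<M> l) $ R
        = real (x $ R - (if R \<in> ?E then 1 else 0) + card {P\<in>?E. w P = R})"
      using x[of R] by (auto simp: real_state_def)
    then show ?thesis by blast
  qed
  then obtain y where y: "\<And>R. (real_state x + transition_vec \<M> l) $ R = real (y R)" by metis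
  have eq: "real_state (\<chi> R. y R) = real_state x + transition_vec \<M> l"
    using y by (simp add: vec_eq_iff real_state_def)
  have "rate_fun \<M> (real_state x) l \<le> jump_rate \<M> x (\<chi> R. y R)"
    unfolding jump_rate_def
    by (intro member_le_sum rate_fun_nonneg \<M>)
      (use l eq finite_labelled_activities[OF \<M>] in \<open>auto simp: real_state_def\<close>)
  then show ?thesis using that[of "\<chi> R. y R"] eq pos by simp
qed

text \<open>Interchanging the sums regroups the jumps by activity instead of by target.
  \<open>G\<close> takes real vectors because an activity of rate zero may point to a vector with a
  negative coordinate.\<close>

lemma sum_jump_rate_eq_sum_activities:
  fixes \<M> :: "('a, 'd::finite, 'c) pepa" and G :: "real^'d \<Rightarrow> real"
  assumes \<M>: "pepa_model \<M>" and x: "x \<in> reachable \<M> x0"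
  shows "(\<Sum>y\<in>reachable \<M> x0 - {x}. jump_rate \<M> x y * (G (real_state y) - G (real_state x)))
    = (\<Sum>l\<in>labelled_activities \<M>. rate_fun \<M> (real_state x) l *
        (G (real_state x + transition_vec \<M> l) - G (real_state x)))"
proof -
  let ?S = "reachable \<M> x0" and ?L = "labelled_activities \<M>"
  let ?f = "rate_fun \<M> (real_state x)" and ?v = "transition_vec \<M>"
  note fin = finite_labelled_activities[OF \<M>] finite_reachable[of \<M> x0]
  have "(\<Sum>y\<in>?S - {x}. jump_rate \<M> x y * (G (real_state y) - G (real_state x)))
    = (\<Sum>y\<in>?S - {x}. \<Sum>l\<in>{l\<in>?L. real_state y = real_state x + ?v l}.
        ?f l * (G (real_state x + ?v l) - G (real_state x)))"
    by (auto simp: jump_rate_def sum_distrib_right intro!: sum.cong)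
  also have "\<dots> = (\<Sum>l\<in>?L. \<Sum>y\<in>{y\<in>?S - {x}. real_state y = real_state x + ?v l}.
        ?f l * (G (real_state x + ?v l) - G (real_state x)))"
    using fin by (intro sum.swap_restrict) auto
  also have "\<dots> = (\<Sum>l\<in>?L. ?f l * (G (real_state x + ?v l) - G (real_state x)))"
  proof (intro sum.cong refl)
    fix l assume l: "l \<in> ?L"
    show "(\<Sum>y\<in>{y\<in>?S - {x}. real_state y = real_state x + ?v l}.
        ?f l * (G (real_state x + ?v l) - G (real_state x)))
        = ?f l * (G (real_state x + ?v l) - G (real_state x))"
    \<comment> \<open>If the rate or the vector is zero, both sides vanish. Otherwise the target is
      exactly one reachable state, different from \<open>x\<close>.\<close>
    proof (cases "?f l = 0 \<or> ?v l = 0")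
      case False
      then have "0 < ?f l"
        using rate_fun_nonneg[OF \<M> l, of "real_state x"] by (auto simp: real_state_def less_le)
      then obtain y where y: "real_state y = real_state x + ?v l" "0 < jump_rate \<M> x y"
        using transition_target[OF \<M> l] by metis
      have "y \<in> ?S" using x y(2) unfolding reachable_def by (auto intro: rtranclp.rtrancl_into_rtrancl)
      moreover have "y \<noteq> x" using y False by auto
      ultimately have "{y\<in>?S - {x}. real_state y = real_state x + ?v l} = {y}"
        by (auto simp: y(1)[symmetric] real_state_inject)
      then show ?thesis by simp
    qed auto
  qed
  finally show ?thesis .
qed

text \<open>Every transition vector sums to zero. As coordinates are nonnegative, the conserved
  total bounds the norm of all rescaled states uniformly in \<open>n\<close>.\<close>

lemma population_reachable:
  fixes \<M> :: "('a, 'd::finite, 'c) pepa"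
  assumes "y \<in> reachable \<M> x"
  shows "(\<Sum>P\<in>UNIV. real_state y $ P) = (\<Sum>P\<in>UNIV. real_state x $ P)"
proof -
  have step: "(\<Sum>P\<in>UNIV. real_state v $ P) = (\<Sum>P\<in>UNIV. real_state u $ P)"
    if "jump_rate \<M> u v > 0" for u v
  proof -
    have "{l. l \<in> labelled_activities \<M> \<and> real_state v = real_state u + transition_vec \<M> l} \<noteq> {}"
      using that unfolding jump_rate_def by (metis (no_types, lifting) less_irrefl sum.empty)
    then obtain l where "real_state v = real_state u + transition_vec \<M> l" by blast
    then show ?thesis by (simp add: sum.distrib sum_transition_vec)
  qed
  have "(\<lambda>u v. jump_rate \<M> u v > 0)\<^sup>*\<^sup>* x y" using assms by (simp add: reachable_def)
  then show ?thesis by (induction rule: rtranclp_induct) (auto dest: step)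
qed

section \<open>Drift of the fourth power of the deviation\<close>

text \<open>In the exact expansion the term \<open>4 * (D \<bullet> v) * (v \<bullet> v)\<close> is
  at most \<open>4 * (D \<bullet> v)\<^sup>2 + (v \<bullet> v)\<^sup>2\<close>. Cauchy--Schwarz then
  turns the resulting \<open>8 * (D \<bullet> v)\<^sup>2\<close> into eight of the ten middle
  terms.\<close>

lemma quartic_increment_le:
  fixes D v :: "'b::real_inner"
  shows "((D + v) \<bullet> (D + v))\<^sup>2 - (D \<bullet> D)\<^sup>2
    \<le> 4 * (D \<bullet> D) * (D \<bullet> v) + 10 * (D \<bullet> D) * (v \<bullet> v) + 2 * (v \<bullet> v)\<^sup>2"
proof -
  have "(D \<bullet> v)\<^sup>2 \<le> (D \<bullet> D) * (v \<bullet> v)" by (rule Cauchy_Schwarz_ineq)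
  moreover have "0 \<le> (2 * (D \<bullet> v) - v \<bullet> v)\<^sup>2" by simp
  moreover have "(D + v) \<bullet> (D + v) = D \<bullet> D + 2 * (D \<bullet> v) + v \<bullet> v"
    by (simp add: inner_add_left inner_add_right inner_commute)
  ultimately show ?thesis by (simp add: power2_eq_square algebra_simps)
qed

text \<open>The first sum is the generator in rescaled coordinates applied to the fourth power of
  the distance to \<open>\<xi>\<close>; the second term is the time derivative when
  \<open>\<xi>\<close> follows the ODEs. Their first-order parts cancel up to a Lipschitz error, and
  the higher-order jump terms are small in \<open>n\<close>.\<close>

lemma quartic_drift_bound:
  fixes \<M> :: "('a, 'd::finite, 'c) pepa"
  assumes \<M>: "pepa_model \<M>" and r: "0 \<le> r"
  obtains C where "0 \<le> C"
    "\<And>z \<xi> n. (\<And>P. 0 \<le> z $ P) \<Longrightarrow> norm z \<le> r \<Longrightarrow> n \<ge> (1::nat) \<Longrightarrow>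
      (\<Sum>l\<in>labelled_activities \<M>. real n * rate_fun \<M> z l *
        (((z - \<xi> + transition_vec \<M> l /\<^sub>R n) \<bullet> (z - \<xi> + transition_vec \<M> l /\<^sub>R n))\<^sup>2
          - ((z - \<xi>) \<bullet> (z - \<xi>))\<^sup>2))
      - 4 * ((z - \<xi>) \<bullet> (z - \<xi>)) * ((z - \<xi>) \<bullet>
          (\<Sum>l\<in>labelled_activities \<M>. rate_fun \<M> \<xi> l *\<^sub>R transition_vec \<M> l))
      \<le> C * (((z - \<xi>) \<bullet> (z - \<xi>))\<^sup>2 + 1 / (real n)\<^sup>2)"
proof -
  obtain L where L: "0 \<le> L"
    "\<And>l z z'. l \<in> labelled_activities \<M> \<Longrightarrow> \<bar>rate_fun \<M> z l - rate_fun \<M> z' l\<bar> \<le> L * norm (z - z')"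
    "\<And>l z. l \<in> labelled_activities \<M> \<Longrightarrow> rate_fun \<M> z l \<le> L * norm z"
    "\<And>l. l \<in> labelled_activities \<M> \<Longrightarrow> norm (transition_vec \<M> l) \<le> L"
    using rate_fun_uniform_bounds[OF \<M>] by blast
  \<comment> \<open>The first summand comes from the Lipschitz error of the drift, the second from
    the higher-order terms, whose rates are at most \<open>L * r\<close>.\<close>
  define K where "K = 4 * L\<^sup>2 + L * r * (10 * L\<^sup>2 + 2 * (L\<^sup>2)\<^sup>2)"
  show ?thesis
  proof (rule that[of "card (labelled_activities \<M>) * K"])
    show "0 \<le> card (labelled_activities \<M>) * K" using L(1) r by (simp add: K_def)
    fix z \<xi> :: "real^'d" and n :: nat
    assume z: "\<And>P. 0 \<le> z $ P" "norm z \<le> r" and n: "n \<ge> 1"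
    define D where "D = z - \<xi>"
    define A where "A = D \<bullet> D"
    have A0: "0 \<le> A" by (simp add: A_def)
    have "real n * rate_fun \<M> z l *
        (((D + transition_vec \<M> l /\<^sub>R n) \<bullet> (D + transition_vec \<M> l /\<^sub>R n))\<^sup>2 - A\<^sup>2)
        - 4 * A * (D \<bullet> (rate_fun \<M> \<xi> l *\<^sub>R transition_vec \<M> l)) \<le> K * (A\<^sup>2 + 1 / (real n)\<^sup>2)"
      if l: "l \<in> labelled_activities \<M>" for l
    proof -
      define f where "f = rate_fun \<M> z l"
      define g where "g = rate_fun \<M> \<xi> l"
      define v where "v = transition_vec \<M> l"
      have f: "0 \<le> f" "f \<le> L * r"
        using rate_fun_nonneg[OF \<M> l z(1)] L(3)[OF l, of z] mult_left_mono[OF z(2) L(1)]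
        by (auto simp: f_def)
      have v: "norm v \<le> L" using L(4)[OF l] by (simp add: v_def)
      have v2: "v \<bullet> v \<le> L\<^sup>2" using v by (metis norm_ge_zero power2_norm_eq_inner power_mono)
      have v4: "(v \<bullet> v)\<^sup>2 \<le> (L\<^sup>2)\<^sup>2" by (rule power_mono[OF v2]) simp
      have inv: "0 < 1 / real n" "1 / real n \<le> 1" using n by auto
      \<comment> \<open>The mixed term \<open>A / n\<close> is split by the inequality of arithmetic
        and geometric means, which produces the order \<open>1 / n\<^sup>2\<close>.\<close>
      have "0 \<le> A * (1 / n)" using A0 by simp
      then have "A * (1 / n) \<le> A\<^sup>2 + (1 / real n)\<^sup>2"
        using sum_squares_bound[of A "1 / real n"] by linarith
      then have amgm: "A / n \<le> A\<^sup>2 + 1 / (real n)\<^sup>2" by (simp add: power_divide)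
      have n3: "1 / (real n) ^ 3 \<le> A\<^sup>2 + 1 / (real n)\<^sup>2"
      proof -
        have "1 / (real n) ^ 3 \<le> 1 / (real n)\<^sup>2"
          using n by (intro divide_left_mono power_increasing) auto
        then show ?thesis by (simp add: add_increasing)
      qed
      have "real n * f * (((D + v /\<^sub>R n) \<bullet> (D + v /\<^sub>R n))\<^sup>2 - A\<^sup>2)
          \<le> real n * f * (4 * A * (D \<bullet> (v /\<^sub>R n)) + 10 * A * ((v /\<^sub>R n) \<bullet> (v /\<^sub>R n)) + 2 * ((v /\<^sub>R n) \<bullet> (v /\<^sub>R n))\<^sup>2)"
        unfolding A_def by (intro mult_left_mono quartic_increment_le) (use f in auto)
      also have "\<dots> = 4 * A * f * (D \<bullet> v) + f * (10 * (A / n) * (v \<bullet> v) + 2 * (v \<bullet> v)\<^sup>2 * (1 / (real n) ^ 3))"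
        using n by (simp add: field_simps power2_eq_square power3_eq_cube)
      also have "f * (10 * (A / n) * (v \<bullet> v) + 2 * (v \<bullet> v)\<^sup>2 * (1 / (real n) ^ 3))
          \<le> (L * r) * (10 * (A\<^sup>2 + 1 / (real n)\<^sup>2) * L\<^sup>2 + 2 * (L\<^sup>2)\<^sup>2 * (A\<^sup>2 + 1 / (real n)\<^sup>2))"
        by (intro mult_mono add_mono v2 v4 amgm n3 f)
          (use L(1) r A0 f in \<open>auto intro!: add_nonneg_nonneg mult_nonneg_nonneg\<close>)
      also have "\<dots> = L * r * (10 * L\<^sup>2 + 2 * (L\<^sup>2)\<^sup>2) * (A\<^sup>2 + 1 / (real n)\<^sup>2)"
        by (simp add: algebra_simps)
      finally have 1: "real n * f * (((D + v /\<^sub>R n) \<bullet> (D + v /\<^sub>R n))\<^sup>2 - A\<^sup>2)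
        \<le> 4 * A * f * (D \<bullet> v) + L * r * (10 * L\<^sup>2 + 2 * (L\<^sup>2)\<^sup>2) * (A\<^sup>2 + 1 / (real n)\<^sup>2)"
        by simp
      \<comment> \<open>The jump term carries the rate at \<open>z\<close> and the time derivative
        the rate at \<open>\<xi>\<close>, so only \<open>f - g\<close> remains of the first
        order.\<close>
      have "(f - g) * (D \<bullet> v) \<le> \<bar>f - g\<bar> * \<bar>D \<bullet> v\<bar>"
        by (metis abs_ge_self abs_mult)
      also have "\<dots> \<le> (L * norm D) * (norm D * L)"
      proof (intro mult_mono)
        show "\<bar>f - g\<bar> \<le> L * norm D" using L(2)[OF l, of z \<xi>] by (simp add: f_def g_def D_def)
        show "\<bar>D \<bullet> v\<bar> \<le> norm D * L"
          using Cauchy_Schwarz_ineq2[of D v] mult_left_mono[OF v, of "norm D"] by simp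
      qed (use L(1) in auto)
      also have "\<dots> = L\<^sup>2 * A" by (simp add: A_def power2_norm_eq_inner[symmetric] power2_eq_square)
      finally have "4 * A * ((f - g) * (D \<bullet> v)) \<le> 4 * A * (L\<^sup>2 * A)"
        using A0 by (intro mult_left_mono) auto
      also have "\<dots> = 4 * L\<^sup>2 * A\<^sup>2" by (simp add: power2_eq_square)
      also have "\<dots> \<le> 4 * L\<^sup>2 * (A\<^sup>2 + 1 / (real n)\<^sup>2)" by (intro mult_left_mono) auto
      finally have "4 * A * f * (D \<bullet> v) - 4 * A * (D \<bullet> (g *\<^sub>R v)) \<le> 4 * L\<^sup>2 * (A\<^sup>2 + 1 / (real n)\<^sup>2)"
        by (simp add: algebra_simps)
      with 1 have "real n * f * (((D + v /\<^sub>R n) \<bullet> (D + v /\<^sub>R n))\<^sup>2 - A\<^sup>2) - 4 * A * (D \<bullet> (g *\<^sub>R v))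
          \<le> K * (A\<^sup>2 + 1 / (real n)\<^sup>2)"
        unfolding K_def distrib_right by linarith
      then show ?thesis by (simp only: f_def g_def v_def)
    qed
    then have "(\<Sum>l\<in>labelled_activities \<M>. real n * rate_fun \<M> z l *
        (((D + transition_vec \<M> l /\<^sub>R n) \<bullet> (D + transition_vec \<M> l /\<^sub>R n))\<^sup>2 - A\<^sup>2)
        - 4 * A * (D \<bullet> (rate_fun \<M> \<xi> l *\<^sub>R transition_vec \<M> l)))
        \<le> (\<Sum>l\<in>labelled_activities \<M>. K * (A\<^sup>2 + 1 / (real n)\<^sup>2))"
      by (rule sum_mono)
    then show "(\<Sum>l\<in>labelled_activities \<M>. real n * rate_fun \<M> z l *
        (((z - \<xi> + transition_vec \<M> l /\<^sub>R n) \<bullet> (z - \<xi> + transition_vec \<M> l /\<^sub>R n))\<^sup>2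
          - ((z - \<xi>) \<bullet> (z - \<xi>))\<^sup>2))
      - 4 * ((z - \<xi>) \<bullet> (z - \<xi>)) * ((z - \<xi>) \<bullet>
          (\<Sum>l\<in>labelled_activities \<M>. rate_fun \<M> \<xi> l *\<^sub>R transition_vec \<M> l))
      \<le> card (labelled_activities \<M>) * K * (((z - \<xi>) \<bullet> (z - \<xi>))\<^sup>2 + 1 / (real n)\<^sup>2)"
      unfolding D_def[symmetric] A_def[symmetric] inner_sum_right sum_distrib_left
      by (simp add: sum_subtractf mult.assoc)
  qed
qed

section \<open>Deviation from the solution of the derived ODEs\<close>

lemma derived_ode_solution_quartic_derivative:
  fixes \<M> :: "('a, 'd::finite, 'c) pepa"
  assumes "derived_ode_solution \<M> x0 X" "0 \<le> t"
  shows "((\<lambda>t. ((z - X t) \<bullet> (z - X t))\<^sup>2) has_real_derivative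
    - 4 * ((z - X t) \<bullet> (z - X t)) * ((z - X t) \<bullet>
      (\<Sum>l\<in>labelled_activities \<M>. rate_fun \<M> (X t) l *\<^sub>R transition_vec \<M> l)))
    (at t within {0..})"
proof -
  let ?F = "\<Sum>l\<in>labelled_activities \<M>. rate_fun \<M> (X t) l *\<^sub>R transition_vec \<M> l"
  have "(X has_vector_derivative ?F) (at t within {0..})"
    using assms by (simp add: derived_ode_solution_def)
  then have "((\<lambda>t. z - X t) has_vector_derivative - ?F) (at t within {0..})"
    by (auto intro!: derivative_eq_intros)
  from bounded_bilinear.has_vector_derivative[OF bounded_bilinear_inner this this]
  have "((\<lambda>t. (z - X t) \<bullet> (z - X t)) has_real_derivative - 2 * ((z - X t) \<bullet> ?F)) (at t within {0..})"
    by (simp add: has_real_derivative_iff_has_vector_derivative inner_commute)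
  then show ?thesis
    by (auto intro!: derivative_eq_intros)
qed

text \<open>The dyadic maximal inequality is applied to a supersolution built from the fourth power
  of the deviation. One constant, independent of \<open>n\<close> and \<open>a\<close>, serves both
  as the factor \<open>C * T\<close> in the probability and as the factor \<open>exp (C * T)\<close>
  lost when the exponential weight is undone.\<close>

lemma density_dependent_deviation_bound:
  fixes \<M> :: "('a, 'd::finite, 'c) pepa" and x0 :: "nat^'d"
  assumes \<M>: "pepa_model \<M>" and ode: "derived_ode_solution \<M> x0 X"
    and Xn: "density_dependent_ctmcs M \<M> x0 Xn" and T: "0 \<le> T"
  obtains K where "0 \<le> K"
    "\<And>n a. n \<ge> 1 \<Longrightarrow> 0 < a \<Longrightarrow>
      \<exists>B\<in>sets M. measure M B \<le> K / a / (real n)\<^sup>2 \<and>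
        (\<forall>\<omega>\<in>space M - B. \<forall>m. \<forall>k\<le>2 ^ m.
          norm (real_state (Xn n (T * real k / 2 ^ m) \<omega>) /\<^sub>R n - X (T * real k / 2 ^ m)) ^ 4 \<le> K * a)"
proof -
  define r where "r = (\<Sum>P\<in>UNIV. real_state x0 $ P)"
  have r: "0 \<le> r" by (auto simp: r_def real_state_def intro!: sum_nonneg)
  obtain C where C: "0 \<le> C"
    "\<And>z \<xi> n. (\<And>P. 0 \<le> z $ P) \<Longrightarrow> norm z \<le> r \<Longrightarrow> n \<ge> (1::nat) \<Longrightarrow>
      (\<Sum>l\<in>labelled_activities \<M>. real n * rate_fun \<M> z l *
        (((z - \<xi> + transition_vec \<M> l /\<^sub>R n) \<bullet> (z - \<xi> + transition_vec \<M> l /\<^sub>R n))\<^sup>2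
          - ((z - \<xi>) \<bullet> (z - \<xi>))\<^sup>2))
      - 4 * ((z - \<xi>) \<bullet> (z - \<xi>)) * ((z - \<xi>) \<bullet>
          (\<Sum>l\<in>labelled_activities \<M>. rate_fun \<M> \<xi> l *\<^sub>R transition_vec \<M> l))
      \<le> C * (((z - \<xi>) \<bullet> (z - \<xi>))\<^sup>2 + 1 / (real n)\<^sup>2)"
    using quartic_drift_bound[OF \<M> r] by blast
  show ?thesis
  proof (rule that[of "C * T + exp (C * T)"])
    show "0 \<le> C * T + exp (C * T)" using C(1) T by simp
    fix n :: nat and a :: real assume n: "n \<ge> 1" and a: "0 < a"
    define nx0 :: "nat^'d" where "nx0 = (\<chi> P. n * x0 $ P)"
    let ?S = "reachable \<M> nx0"
    define z where "z x = real_state x /\<^sub>R n" for x :: "nat^'d"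
    define V where "V t \<zeta> = ((\<zeta> - X t) \<bullet> (\<zeta> - X t))\<^sup>2" for t \<zeta>
    define V' where "V' t \<zeta> = - 4 * ((\<zeta> - X t) \<bullet> (\<zeta> - X t)) * ((\<zeta> - X t) \<bullet>
      (\<Sum>l\<in>labelled_activities \<M>. rate_fun \<M> (X t) l *\<^sub>R transition_vec \<M> l))" for t \<zeta>
    define \<kappa> where "\<kappa> = C / (real n)\<^sup>2"
    \<comment> \<open>The exponential absorbs the growth \<open>C * V\<close>, and the decreasing
      linear term absorbs the inhomogeneity \<open>\<kappa>\<close> while staying nonnegative up to
      \<open>T\<close>.\<close>
    define H where "H t x = exp (- C * t) * V t (z x) + \<kappa> * (T - t)" for t x
    define H' where "H' t x = exp (- C * t) * (V' t (z x) - C * V t (z x)) - \<kappa>" for t x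
    have ctmc: "ctmc M ?S (jump_rate \<M>) nx0 (Xn n)"
      using Xn n by (simp add: density_dependent_ctmcs_def nx0_def Let_def)
    have \<kappa>: "0 \<le> \<kappa>" using C(1) by (simp add: \<kappa>_def)
    have V0: "0 \<le> V t \<zeta>" for t \<zeta> by (simp add: V_def)
    have H_nonneg: "0 \<le> H t x" if "0 \<le> t" "t \<le> T" for t x
      unfolding H_def using \<kappa> V0 that by simp
    have H_deriv: "((\<lambda>t. H t x) has_real_derivative H' t x) (at t within {0..T})"
      if "0 \<le> t" "t \<le> T" for t x
    proof -
      have "((\<lambda>t. V t (z x)) has_real_derivative V' t (z x)) (at t within {0..T})"
        unfolding V_def V'_def
        by (rule has_field_derivative_subset[OF derived_ode_solution_quartic_derivative[OF ode that(1)]])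
          auto
      then show ?thesis
        unfolding H_def H'_def
        by (auto intro!: derivative_eq_intros simp: algebra_simps)
    qed
    have H_super: "H' t x + (\<Sum>y\<in>?S. generator ?S (jump_rate \<M>) x y * H t y) \<le> 0"
      if t: "0 \<le> t" "t \<le> T" and x: "x \<in> ?S" for t x
    proof -
      define G where "G \<zeta> = exp (- C * t) * V t (\<zeta> /\<^sub>R n) + \<kappa> * (T - t)" for \<zeta>
      have HG: "H t y = G (real_state y)" for y by (simp add: H_def G_def z_def)
      have zx: "0 \<le> z x $ P" for P by (simp add: z_def real_state_def)
      \<comment> \<open>For nonnegative coordinates the l1 norm is the rescaled total population,
        which equals its initial value \<open>r\<close>.\<close>
      have "norm (z x) \<le> (\<Sum>P\<in>UNIV. \<bar>z x $ P\<bar>)" by (rule norm_le_l1_cart)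
      also have "\<dots> = (\<Sum>P\<in>UNIV. real_state x $ P) / n"
        using zx by (simp add: z_def sum_distrib_left divide_inverse mult.commute)
      also have "\<dots> = r"
        unfolding population_reachable[OF x] r_def using n
        by (simp add: nx0_def real_state_def sum_distrib_left[symmetric])
      finally have norm_zx: "norm (z x) \<le> r" .
      have "(\<Sum>y\<in>?S. generator ?S (jump_rate \<M>) x y * H t y)
          = (\<Sum>l\<in>labelled_activities \<M>. rate_fun \<M> (real_state x) l *
              (G (real_state x + transition_vec \<M> l) - G (real_state x)))"
        unfolding HG
        by (simp add: sum_generator finite_reachable x sum_jump_rate_eq_sum_activities[OF \<M> x])
      also have "\<dots> = exp (- C * t) * (\<Sum>l\<in>labelled_activities \<M>. n * rate_fun \<M> (z x) l *
              (V t (z x + transition_vec \<M> l /\<^sub>R n) - V t (z x)))"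
        unfolding sum_distrib_left
      proof (intro sum.cong refl)
        fix l assume l: "l \<in> labelled_activities \<M>"
        have "rate_fun \<M> (real_state x) l = n * rate_fun \<M> (z x) l"
          using rate_fun_scaleR[OF \<M> l, of "real n" "z x"] n by (simp add: z_def)
        then show "rate_fun \<M> (real_state x) l *
              (G (real_state x + transition_vec \<M> l) - G (real_state x))
            = exp (- C * t) * (n * rate_fun \<M> (z x) l *
              (V t (z x + transition_vec \<M> l /\<^sub>R n) - V t (z x)))"
          by (simp add: G_def z_def scaleR_add_right algebra_simps)
      qed
      finally have gen: "(\<Sum>y\<in>?S. generator ?S (jump_rate \<M>) x y * H t y)
          = exp (- C * t) * (\<Sum>l\<in>labelled_activities \<M>. n * rate_fun \<M> (z x) l *
              (V t (z x + transition_vec \<M> l /\<^sub>R n) - V t (z x)))" .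
      have "(\<Sum>l\<in>labelled_activities \<M>. n * rate_fun \<M> (z x) l *
              (V t (z x + transition_vec \<M> l /\<^sub>R n) - V t (z x))) + V' t (z x)
          \<le> C * (V t (z x) + 1 / (real n)\<^sup>2)"
        using C(2)[OF zx norm_zx n, of "X t"]
        by (simp add: V_def V'_def algebra_simps)
      then have "exp (- C * t) * ((\<Sum>l\<in>labelled_activities \<M>. n * rate_fun \<M> (z x) l *
              (V t (z x + transition_vec \<M> l /\<^sub>R n) - V t (z x))) + V' t (z x) - C * V t (z x))
          \<le> exp (- C * t) * \<kappa>"
        by (intro mult_left_mono) (auto simp: algebra_simps \<kappa>_def)
      \<comment> \<open>The weight is at most 1, so what remains is cancelled by the
        \<open>- \<kappa>\<close> in \<open>H'\<close>.\<close>
      also have "\<dots> \<le> 1 * \<kappa>"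
        using C(1) \<kappa> t by (intro mult_right_mono) auto
      finally show ?thesis
        unfolding gen H'_def by (simp add: algebra_simps)
    qed
    define B where "B = {\<omega> \<in> space M. \<exists>m. \<exists>k\<le>2 ^ m.
      a \<le> H (T * real k / 2 ^ m) (Xn n (T * real k / 2 ^ m) \<omega>)}"
    have nx0: "nx0 \<in> ?S" by (simp add: reachable_def)
    note maximal = ctmc_dyadic_maximal[OF ctmc finite_reachable nx0 jump_rate_nonneg[OF \<M>]
        H_deriv H_super H_nonneg less_imp_le[OF a] T, folded B_def]
    \<comment> \<open>The rescaled chain starts on the solution, so only the linear term of
      \<open>H\<close> survives at time 0.\<close>
    have "z nx0 = X 0"
      using n ode by (simp add: z_def nx0_def derived_ode_solution_def real_state_def vec_eq_iff)
    then have "H 0 nx0 = C * T / (real n)\<^sup>2" by (simp add: H_def V_def \<kappa>_def)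
    then have "measure M B * a \<le> C * T / (real n)\<^sup>2"
      using maximal(2) by (simp add: mult.commute)
    then have "measure M B \<le> C * T / (real n)\<^sup>2 / a"
      using a by (simp only: pos_le_divide_eq)
    also have "\<dots> \<le> (C * T + exp (C * T)) / a / (real n)\<^sup>2"
      using a by (simp add: add_divide_distrib mult.commute[of a])
    finally have B: "measure M B \<le> (C * T + exp (C * T)) / a / (real n)\<^sup>2" .
    have "norm (z (Xn n u \<omega>) - X u) ^ 4 \<le> (C * T + exp (C * T)) * a"
      if \<omega>: "\<omega> \<in> space M - B" and k: "k \<le> 2 ^ m" and u: "u = T * real k / 2 ^ m" for \<omega> m k u
    proof -
      have "real k \<le> 2 ^ m" using k by (metis of_nat_le_iff of_nat_numeral of_nat_power)
      then have u0: "0 \<le> u" "u \<le> T"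
        using T by (auto simp: u divide_le_eq intro!: mult_left_mono)
      have "\<not> a \<le> H u (Xn n u \<omega>)" using \<omega> k unfolding B_def u by blast
      moreover have "0 \<le> \<kappa> * (T - u)" using \<kappa> u0 by simp
      ultimately have "exp (- C * u) * V u (z (Xn n u \<omega>)) \<le> a" by (simp add: H_def not_le)
      then have "V u (z (Xn n u \<omega>)) \<le> exp (C * u) * a"
        by (simp add: exp_minus field_simps)
      also have "\<dots> \<le> (C * T + exp (C * T)) * a"
        using a C(1) u0 T by (intro mult_right_mono add_increasing) (auto intro: mult_left_mono)
      finally show ?thesis
        by (simp add: V_def power2_norm_eq_inner[symmetric] flip: power_mult)
    qed
    with B maximal(1) show "\<exists>B\<in>sets M. measure M B \<le> (C * T + exp (C * T)) / a / (real n)\<^sup>2 \<and>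
        (\<forall>\<omega>\<in>space M - B. \<forall>m. \<forall>k\<le>2 ^ m.
          norm (real_state (Xn n (T * real k / 2 ^ m) \<omega>) /\<^sub>R n - X (T * real k / 2 ^ m)) ^ 4
            \<le> (C * T + exp (C * T)) * a)"
      unfolding z_def by blast
  qed
qed

section \<open>From dyadic times to all times\<close>

text \<open>Once the mesh \<open>T / 2 ^ m\<close> is smaller than \<open>b - u\<close>, the first
  grid point beyond \<open>u\<close> lies before \<open>b\<close>.\<close>

lemma dyadic_between:
  fixes u b T :: real
  assumes "0 \<le> u" "u < b" "b \<le> T"
  shows "\<exists>m k. k \<le> 2 ^ m \<and> u < T * real k / 2 ^ m \<and> T * real k / 2 ^ m < b"
proof -
  have T: "0 < T" using assms by linarith
  obtain m where m: "T / (b - u) < 2 ^ m" using real_arch_pow[of 2 "T / (b - u)"] by auto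
  \<comment> \<open>Floor plus one, rather than the ceiling, keeps the grid point strictly to the
    right of \<open>u\<close> even when \<open>u\<close> lies on the grid.\<close>
  define k where "k = nat (\<lfloor>u * 2 ^ m / T\<rfloor> + 1)"
  have "0 \<le> u * 2 ^ m / T" using assms T by simp
  then have k: "real k = of_int \<lfloor>u * 2 ^ m / T\<rfloor> + 1" by (simp add: k_def)
  have "u * 2 ^ m / T < real k" "real k \<le> u * 2 ^ m / T + 1" unfolding k by linarith+
  then have "u * 2 ^ m < T * real k" "T * real k \<le> u * 2 ^ m + T"
    using T by (auto simp: field_simps)
  moreover have "T < (b - u) * 2 ^ m" using m assms by (simp add: field_simps)
  ultimately have "u < T * real k / 2 ^ m" and lt: "T * real k < b * 2 ^ m"
    by (auto simp: field_simps)
  moreover have "b * 2 ^ m \<le> T * 2 ^ m" using assms(3) by (intro mult_right_mono) auto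
  with lt have "T * real k < T * 2 ^ m" by (rule less_le_trans)
  then have "real k < 2 ^ m" using T by simp
  then have "k \<le> 2 ^ m" by (metis less_imp_le of_nat_less_iff of_nat_numeral of_nat_power)
  ultimately show ?thesis by (intro exI[of _ m] exI[of _ k]) (simp add: divide_less_eq)
qed

text \<open>A violation at \<open>u\<close> persists on an interval to the right of
  \<open>u\<close>, since \<open>x\<close> is constant there and \<open>Y\<close> is continuous;
  that interval contains a dyadic time.\<close>

lemma right_continuous_step_deviation_le:
  fixes x :: "real \<Rightarrow> 's" and f :: "'s \<Rightarrow> 'b::real_normed_vector"
  assumes T: "0 < T" and Y: "continuous_on {0..T} Y"
    and x: "\<And>t. 0 \<le> t \<Longrightarrow> \<forall>\<^sub>F s in at_right t. x s = x t"
    and dyadic: "\<And>m k. k \<le> 2 ^ m \<Longrightarrow>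
      norm (f (x (T * real k / 2 ^ m)) - Y (T * real k / 2 ^ m)) \<le> c"
    and u: "u \<in> {0..T}"
  shows "norm (f (x u) - Y u) \<le> c"
proof (cases "u = T")
  case True
  \<comment> \<open>The right endpoint has no room to its right, but it is itself the grid point
    with \<open>k = 1\<close> and \<open>m = 0\<close>.\<close>
  then show ?thesis using dyadic[of 1 0] by simp
next
  case False
  show ?thesis
  proof (rule ccontr)
    assume gt: "\<not> norm (f (x u) - Y u) \<le> c"
    have "(Y \<longlongrightarrow> Y u) (at_right u)"
      using continuous_on_Icc_at_rightD[of u T Y] continuous_on_subset[OF Y, of "{u..T}"] u False
      by auto
    then have "((\<lambda>s. norm (f (x u) - Y s)) \<longlongrightarrow> norm (f (x u) - Y u)) (at_right u)"
      by (intro tendsto_intros)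
    then have "\<forall>\<^sub>F s in at_right u. c < norm (f (x u) - Y s)"
      by (rule order_tendstoD) (use gt in auto)
    moreover have "\<forall>\<^sub>F s in at_right u. x s = x u" using x u by simp
    ultimately have "\<forall>\<^sub>F s in at_right u. c < norm (f (x s) - Y s)"
      by eventually_elim simp
    then obtain b where b: "u < b" "\<And>s. u < s \<Longrightarrow> s < b \<Longrightarrow> c < norm (f (x s) - Y s)"
      unfolding eventually_at_right_field by blast
    have "u < min b T" using b u False by auto
    then obtain m k where "k \<le> 2 ^ m" "u < T * real k / 2 ^ m" "T * real k / 2 ^ m < min b T"
      using dyadic_between[of u "min b T" T] u by (meson atLeastAtMost_iff min.cobounded2)
    then show False using b(2) dyadic[of k m] by (auto simp: not_less[symmetric])
  qed
qed

theorem theorem3: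
  fixes \<M> :: "('a, 'd::finite, 'c) pepa"
    and x0 :: "nat^'d"
    and X :: "real \<Rightarrow> real^'d"
    and M :: "'w measure"
    and Xn :: "nat \<Rightarrow> real \<Rightarrow> 'w \<Rightarrow> nat^'d"
    and t :: real
  assumes "pepa_model \<M>"
    and "derived_ode_solution \<M> x0 X"
    and "density_dependent_ctmcs M \<M> x0 Xn"
    and "t > 0"
  shows "AE \<omega> in M.
    (\<lambda>n. SUP u\<in>{0..t}. norm (real_state (Xn n u \<omega>) /\<^sub>R real n - X u)) \<longlonglongrightarrow> 0"
proof -
  have ctmc: "ctmc M (reachable \<M> (\<chi> P. n * x0 $ P)) (jump_rate \<M>) (\<chi> P. n * x0 $ P) (Xn n)"
    if "n \<ge> 1" for n
    using assms(3) that by (simp add: density_dependent_ctmcs_def Let_def)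
  interpret prob_space M using ctmc[of 1] by (simp add: ctmc_def)
  let ?dev = "\<lambda>n \<omega> u. norm (real_state (Xn n u \<omega>) /\<^sub>R real n - X u)"
  have "continuous_on {0..} X"
    using assms(2) unfolding derived_ode_solution_def continuous_on_eq_continuous_within
    by (auto intro: has_vector_derivative_continuous)
  then have cont: "continuous_on {0..t} X" by (rule continuous_on_subset) auto
  obtain K where K: "0 \<le> K"
    "\<And>n a. n \<ge> 1 \<Longrightarrow> 0 < a \<Longrightarrow>
      \<exists>B\<in>sets M. prob B \<le> K / a / (real n)\<^sup>2 \<and>
        (\<forall>\<omega>\<in>space M - B. \<forall>m. \<forall>k\<le>2 ^ m. ?dev n \<omega> (t * real k / 2 ^ m) ^ 4 \<le> K * a)"
    using density_dependent_deviation_bound[OF assms(1-3) less_imp_le[OF assms(4)]] by metis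
  \<comment> \<open>Borel--Cantelli for a fixed level \<open>a\<close>. The index
    \<open>Suc n\<close> keeps to population scales at least 1, where the chains are
    specified.\<close>
  have dyadic_AE: "AE \<omega> in M. \<forall>\<^sub>F n in sequentially. \<forall>m. \<forall>k\<le>2 ^ m.
      ?dev (Suc n) \<omega> (t * real k / 2 ^ m) ^ 4 \<le> K * a" if a: "0 < a" for a
  proof -
    have "\<forall>n. \<exists>B\<in>sets M. prob B \<le> K / a / (real (Suc n))\<^sup>2 \<and>
        (\<forall>\<omega>\<in>space M - B. \<forall>m. \<forall>k\<le>2 ^ m. ?dev (Suc n) \<omega> (t * real k / 2 ^ m) ^ 4 \<le> K * a)"
      by (intro allI K(2) a) simp
    then obtain B where B: "\<And>n. B n \<in> sets M" "\<And>n. prob (B n) \<le> K / a / (real (Suc n))\<^sup>2"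
      "\<And>n. \<forall>\<omega>\<in>space M - B n. \<forall>m. \<forall>k\<le>2 ^ m.
        ?dev (Suc n) \<omega> (t * real k / 2 ^ m) ^ 4 \<le> K * a"
      by (auto simp only: Bex_def dest!: choice) blast
    have "summable (\<lambda>n. inverse ((real (Suc n))\<^sup>2))"
      using inverse_power_summable[of 2, where 'a=real]
        summable_Suc_iff[of "\<lambda>n. inverse ((real n)\<^sup>2)"] by simp
    then have "summable (\<lambda>n. K / a * inverse ((real (Suc n))\<^sup>2))" by (rule summable_mult)
    then have "summable (\<lambda>n. prob (B n))"
      by (rule summable_comparison_test') (use B(2) in \<open>simp add: divide_inverse\<close>)
    then have "AE \<omega> in M. \<forall>\<^sub>F n in sequentially. \<omega> \<in> space M - B n"
      by (intro borel_cantelli_AE1 B) (auto simp: emeasure_eq_measure)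
    then show ?thesis
      by eventually_elim (rule eventually_mono, assumption, rule bspec[OF B(3)])
  qed
  \<comment> \<open>Restricting the level to the countable family \<open>1 / Suc j\<close> leaves a
    single null set for all levels.\<close>
  have "AE \<omega> in M. \<forall>j. \<forall>\<^sub>F n in sequentially. \<forall>m. \<forall>k\<le>2 ^ m.
      ?dev (Suc n) \<omega> (t * real k / 2 ^ m) ^ 4 \<le> K * (1 / real (Suc j))"
    unfolding AE_all_countable by (intro allI dyadic_AE) simp
  moreover have "AE \<omega> in M. \<forall>n. \<forall>u\<ge>0. \<forall>\<^sub>F s in at_right u. Xn (Suc n) s \<omega> = Xn (Suc n) u \<omega>"
    unfolding AE_all_countable using ctmc[of "Suc _"] by (simp add: ctmc_def)
  ultimately show ?thesis
  proof eventually_elim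
    case (elim \<omega>)
    note right_cont = elim(2)
    have "(\<lambda>n. SUP u\<in>{0..t}. ?dev (Suc n) \<omega> u) \<longlonglongrightarrow> 0"
    proof (rule tendsto_norm_zero_cancel, rule order_tendstoI)
      fix e :: real assume e: "0 < e"
      have "(\<lambda>j. K * (1 / real (Suc j))) \<longlonglongrightarrow> K * 0"
        by (intro tendsto_intros LIMSEQ_Suc[OF lim_1_over_n])
      \<comment> \<open>Aiming at \<open>e / 2\<close> leaves room: a supremum of values at most
        \<open>e / 2\<close> is strictly below \<open>e\<close>.\<close>
      then have "\<forall>\<^sub>F j in sequentially. K * (1 / real (Suc j)) < (e / 2) ^ 4"
        by (rule order_tendstoD) (use e in simp)
      then obtain j where j: "K * (1 / real (Suc j)) < (e / 2) ^ 4"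
        by (auto simp: eventually_sequentially)
      from elim(1) have "\<forall>\<^sub>F n in sequentially. \<forall>m. \<forall>k\<le>2 ^ m.
          ?dev (Suc n) \<omega> (t * real k / 2 ^ m) ^ 4 \<le> K * (1 / real (Suc j))" by blast
      then show "\<forall>\<^sub>F n in sequentially. norm (SUP u\<in>{0..t}. ?dev (Suc n) \<omega> u) < e"
      proof eventually_elim
        case (elim n)
        have dev: "?dev (Suc n) \<omega> u \<le> e / 2" if "u \<in> {0..t}" for u
        proof (rule right_continuous_step_deviation_le[OF assms(4) cont _ _ that,
              where x="\<lambda>s. Xn (Suc n) s \<omega>" and f="\<lambda>y. real_state y /\<^sub>R real (Suc n)"])
          fix m k :: nat assume "k \<le> 2 ^ m"
          then have "?dev (Suc n) \<omega> (t * real k / 2 ^ m) ^ 4 \<le> (e / 2) ^ 4"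
            using elim j by (meson less_imp_le order_trans)
          then show "?dev (Suc n) \<omega> (t * real k / 2 ^ m) \<le> e / 2"
            by (rule power_le_imp_le_base[where n=3, simplified]) (use e in simp)
        qed (use right_cont in blast)
        have "(SUP u\<in>{0..t}. ?dev (Suc n) \<omega> u) \<le> e / 2"
          using assms(4) by (intro cSUP_least dev) auto
        \<comment> \<open>The value at \<open>u = 0\<close> shows that the supremum is nonnegative;
          being an upper bound requires that the set is bounded above, which \<open>dev\<close>
          supplies.\<close>
        moreover have "?dev (Suc n) \<omega> 0 \<le> (SUP u\<in>{0..t}. ?dev (Suc n) \<omega> u)"
          using assms(4) by (intro cSUP_upper bdd_aboveI2[where M="e / 2"] dev) auto
        moreover have "0 \<le> ?dev (Suc n) \<omega> 0" by simp
        ultimately have "\<bar>SUP u\<in>{0..t}. ?dev (Suc n) \<omega> u\<bar> \<le> e / 2" by linarith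
        then show ?case using e by simp
      qed
    qed (auto intro!: always_eventually intro: less_le_trans)
    \<comment> \<open>The term at \<open>n = 0\<close> does not affect the limit, so the shift of
      the index is undone.\<close>
    then show ?case by (rule LIMSEQ_imp_Suc)
  qed
qed

end
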